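(* Let $X\subseteq\mathbb R^d$ be closed and convex with nonempty interior, and let $Q:X\to\mathbb R^d$ be a continuous vector field whose projected dynamics are well-behaved (as defined in the context). Then the dynamic solver $g_Q$ has finitely many reachable terminal outcomes, i.e. $|g_Q(X)|<\infty$, if and only if the projected vector field $Q^{\Pi}:X\to\mathbb R^d$ has finitely many roots (points $x\in X$ with $Q^{\Pi}(x)=0$).
   Context: Tangent cone: $\operatorname{TC}_X(x)=\overline{\{\lambda(y-x): y\in X,\lambda\ge0\}}$, and $\Pi_{\operatorname{TC}_X(x)}$ is the Euclidean projection onto it. Projected vector field: $Q^{\Pi}(x):=\Pi_{\operatorname{TC}_X(x)}Q(x)$. A solution of the projected dynamics from $x_0\in X$ on an interval $I\ni 0$ in $[0,\infty)$ is an $X$-valued path, absolutely continuous on compact subintervals of $I$, with $x(0)=x_0$ and $\dot x(t)=Q^{\Pi}(x(t))$ for a.e. $t$. Well-behaved projected dynamics: there are a lower semicontinuous function $\tau:X\to(0,\infty]$ (maximal existence time) and a map $G:D\to X$, continuous on $D=\{(x_0,t)\in X\times[0,\infty): t<\tau(x_0)\}$, such that for each $x_0\in X$ the path $t\mapsto G(x_0,t)$ is a solution from $x_0$ on $[0,\tau(x_0))$, and is maximal: no solution in $X$ from $x_0$ extends it beyond $\tau(x_0)$, and any other solution from $x_0$ agrees with it on their common domain. Dynamic solver $g_Q:X\to X\sqcup\{\dagger\}$: $g_Q(x_0):=\lim_{t\to\infty}G(x_0,t)$ if $\tau(x_0)=\infty$ and the limit exists in $X$; otherwise $g_Q(x_0):=\dagger$,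 where $\dagger$ is an extra point not in $X$. The set of reachable terminal outcomes is the image $g_Q(X)$. *)

theory Defs
  imports "HOL-Analysis.Analysis"
begin

definition tangent_cone :: "'a::real_normed_vector set \<Rightarrow> 'a \<Rightarrow> 'a set" where
  "tangent_cone X x = closure {c *\<^sub>R (y - x) | c y. y \<in> X \<and> (0::real) \<le> c}"

definition projected_field ::
    "'a::euclidean_space set \<Rightarrow> ('a \<Rightarrow> 'a) \<Rightarrow> 'a \<Rightarrow> 'a" where
  "projected_field X Q x = closest_point (tangent_cone X x) (Q x)"

(* Absolute continuity of a path, in the epsilon-delta sense.  (The library constant
   absolutely_continuous is the unrelated relation between measures.) *)
definition abs_continuous_path_on :: "real set \<Rightarrow> (real \<Rightarrow> 'a::real_normed_vector) \<Rightarrow> bool" where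
  "abs_continuous_path_on S f \<longleftrightarrow>
     (\<forall>\<epsilon>>0. \<exists>\<delta>>0. \<forall>(n::nat) a b.
        (\<forall>i<n. a i \<le> b i \<and> {a i..b i} \<subseteq> S) \<longrightarrow>
        disjoint_family_on (\<lambda>i. {a i<..<b i}) {..<n} \<longrightarrow>
        (\<Sum>i<n. b i - a i) < \<delta> \<longrightarrow>
        (\<Sum>i<n. norm (f (b i) - f (a i))) < \<epsilon>)"

definition lsc_on :: "'a::topological_space set \<Rightarrow> ('a \<Rightarrow> ereal) \<Rightarrow> bool" where
  "lsc_on X \<tau> \<longleftrightarrow> (\<forall>x\<in>X. \<forall>c<\<tau> x. \<forall>\<^sub>F y in at x within X. c < \<tau> y)"

(* Paths are total functions on the reals; only their values on the interval I matter,
   which is why the derivative is taken within I. *)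
definition is_solution ::
    "'a::euclidean_space set \<Rightarrow> ('a \<Rightarrow> 'a) \<Rightarrow> 'a \<Rightarrow> real set \<Rightarrow> (real \<Rightarrow> 'a) \<Rightarrow> bool" where
  "is_solution X Q x0 I x \<longleftrightarrow>
     is_interval I \<and> 0 \<in> I \<and> I \<subseteq> {0..} \<and>
     x ` I \<subseteq> X \<and> x 0 = x0 \<and>
     (\<forall>a b. {a..b} \<subseteq> I \<longrightarrow> abs_continuous_path_on {a..b} x) \<and>
     (AE t in lebesgue. t \<in> I \<longrightarrow>
        (x has_vector_derivative projected_field X Q (x t)) (at t within I))"

definition life_interval :: "('a \<Rightarrow> ereal) \<Rightarrow> 'a \<Rightarrow> real set" where
  "life_interval \<tau> x0 = {t. 0 \<le> t \<and> ereal t < \<tau> x0}"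

(* \<tau> and G are the witnesses of the existential in the notion of well-behaved
   projected dynamics; the last two conjuncts are maximality and uniqueness. *)
definition well_behaved ::
    "'a::euclidean_space set \<Rightarrow> ('a \<Rightarrow> 'a) \<Rightarrow> ('a \<Rightarrow> ereal) \<Rightarrow> ('a \<times> real \<Rightarrow> 'a) \<Rightarrow> bool" where
  "well_behaved X Q \<tau> G \<longleftrightarrow>
     (\<forall>x0\<in>X. 0 < \<tau> x0) \<and> lsc_on X \<tau> \<and>
     continuous_on (SIGMA x0:X. life_interval \<tau> x0) G \<and>
     (\<forall>x0\<in>X.
        is_solution X Q x0 (life_interval \<tau> x0) (\<lambda>t. G (x0, t)) \<and>
        (\<forall>I y. is_solution X Q x0 I y \<longrightarrow>
           \<not> life_interval \<tau> x0 \<subset> I \<and>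
           (\<forall>t \<in> I \<inter> life_interval \<tau> x0. y t = G (x0, t))))"

(* None plays the role of the extra point outside X. *)
definition dynamic_solver ::
    "'a::euclidean_space set \<Rightarrow> ('a \<Rightarrow> ereal) \<Rightarrow> ('a \<times> real \<Rightarrow> 'a) \<Rightarrow> 'a \<Rightarrow> 'a option" where
  "dynamic_solver X \<tau> G x0 =
     (if \<tau> x0 = \<infinity> \<and> (\<exists>l\<in>X. ((\<lambda>t. G (x0, t)) \<longlongrightarrow> l) at_top)
      then Some (Lim at_top (\<lambda>t. G (x0, t))) else None)"

end

(* Roots are stationary solutions, so each root is its own outcome. Conversely, if G(x0, t) tends
   to l, then by uniqueness G(G(x0, T), s) = G(x0, T + s), and letting T tend to infinity gives
   G(l, s) = l by continuity of G; the path from l is thus constant and l is a root. Hence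
   the outcomes are the roots together with possibly the extra point. *)
theory Submission
  imports Defs
begin

lemma abs_continuous_path_on_const: "abs_continuous_path_on S (\<lambda>t. c)"
  unfolding abs_continuous_path_on_def by (auto intro: exI[of _ 1])

text \<open>Translation preserves the lengths and the disjointness of a family of intervals, so the
  same \<open>\<delta>\<close> serves for the shifted path.\<close>

lemma abs_continuous_path_on_shift:
  fixes f :: "real \<Rightarrow> 'a::real_normed_vector"
  assumes "abs_continuous_path_on {T + a..T + b} f"
  shows "abs_continuous_path_on {a..b} (\<lambda>t. f (T + t))"
  unfolding abs_continuous_path_on_def
proof (intro allI impI)
  fix \<epsilon> :: real
  assume "\<epsilon> > 0"
  with assms obtain \<delta> where "\<delta> > 0" and
    \<delta>: "\<forall>(n::nat) u v. (\<forall>i<n. u i \<le> v i \<and> {u i..v i} \<subseteq> {T + a..T + b}) \<longrightarrow>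
          disjoint_family_on (\<lambda>i. {u i<..<v i}) {..<n} \<longrightarrow> (\<Sum>i<n. v i - u i) < \<delta> \<longrightarrow>
          (\<Sum>i<n. norm (f (v i) - f (u i))) < \<epsilon>"
    unfolding abs_continuous_path_on_def by blast
  show "\<exists>\<delta>>0. \<forall>(n::nat) u v. (\<forall>i<n. u i \<le> v i \<and> {u i..v i} \<subseteq> {a..b}) \<longrightarrow>
      disjoint_family_on (\<lambda>i. {u i<..<v i}) {..<n} \<longrightarrow> (\<Sum>i<n. v i - u i) < \<delta> \<longrightarrow>
      (\<Sum>i<n. norm (f (T + v i) - f (T + u i))) < \<epsilon>"
  proof (intro exI[of _ \<delta>] conjI allI impI)
    show "\<delta> > 0"
      by fact
    fix n :: nat and u v :: "nat \<Rightarrow> real"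
    assume sub: "\<forall>i<n. u i \<le> v i \<and> {u i..v i} \<subseteq> {a..b}"
      and disj: "disjoint_family_on (\<lambda>i. {u i<..<v i}) {..<n}"
      and len: "(\<Sum>i<n. v i - u i) < \<delta>"
    have "\<forall>i<n. T + u i \<le> T + v i \<and> {T + u i..T + v i} \<subseteq> {T + a..T + b}"
      using sub by auto
    moreover have "disjoint_family_on (\<lambda>i. {T + u i<..<T + v i}) {..<n}"
      unfolding disjoint_family_on_def
    proof (intro ballI impI equals0I)
      fix i j x
      assume "i \<in> {..<n}" "j \<in> {..<n}" "i \<noteq> j"
        and "x \<in> {T + u i<..<T + v i} \<inter> {T + u j<..<T + v j}"
      then have "x - T \<in> {u i<..<v i} \<inter> {u j<..<v j}"
        by auto
      with \<open>i \<in> {..<n}\<close> \<open>j \<in> {..<n}\<close> \<open>i \<noteq> j\<close> show False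
        using disj unfolding disjoint_family_on_def by blast
    qed
    moreover have "(\<Sum>i<n. (T + v i) - (T + u i)) < \<delta>"
      using len by simp
    ultimately show "(\<Sum>i<n. norm (f (T + v i) - f (T + u i))) < \<epsilon>"
      using spec[OF spec[OF spec[OF \<delta>, of n], of "\<lambda>i. T + u i"], of "\<lambda>i. T + v i"] by blast
  qed
qed

text \<open>Turns almost-everywhere statements into statements about negligible sets, where
  invariance under translations and closure under subsets can be applied directly.\<close>

lemma AE_lebesgue_iff_negligible:
  "(AE t in lebesgue. P t) \<longleftrightarrow> negligible {t::'a::euclidean_space. \<not> P t}"
  unfolding eventually_ae_filter_negligible by (blast intro: negligible_subset)

lemma AE_lebesgue_shift:
  fixes T :: "'a::euclidean_space"
  assumes "AE t in lebesgue. P t"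
  shows "AE t in lebesgue. P (T + t)"
proof -
  have "{t. \<not> P (T + t)} = (+) (- T) ` {t. \<not> P t}"
    by (force simp: image_iff)
  with assms show ?thesis
    unfolding AE_lebesgue_iff_negligible by (metis negligible_translation)
qed

lemma is_solution_const:
  assumes "x \<in> X" and "projected_field X Q x = 0"
  shows "is_solution X Q x {0..} (\<lambda>t. x)"
  using assms unfolding is_solution_def
  by (auto simp: abs_continuous_path_on_const is_interval_ci)

text \<open>The equation is autonomous: restarting at time \<open>T\<close> changes neither the
  field nor, after translation, the exceptional null set. This supplies the semigroup law for
  \<open>G\<close>.\<close>

lemma is_solution_shift:
  assumes sol: "is_solution X Q x0 {0..} x" and "0 \<le> T"
  shows "is_solution X Q (x T) {0..} (\<lambda>t. x (T + t))"
proof -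
  have "AE t in lebesgue. t \<in> {0..} \<longrightarrow>
      (x has_vector_derivative projected_field X Q (x t)) (at t within {0..})"
    using sol unfolding is_solution_def by blast
  then have "AE t in lebesgue. T + t \<in> {0..} \<longrightarrow>
      (x has_vector_derivative projected_field X Q (x (T + t))) (at (T + t) within {0..})"
    by (rule AE_lebesgue_shift)
  then have "AE t in lebesgue. t \<in> {0..} \<longrightarrow>
      ((\<lambda>t. x (T + t)) has_vector_derivative projected_field X Q (x (T + t))) (at t within {0..})"
  proof (rule AE_mp, intro AE_I2 impI)
    fix t :: real
    assume deriv: "T + t \<in> {0..} \<longrightarrow>
        (x has_vector_derivative projected_field X Q (x (T + t))) (at (T + t) within {0..})"
      and "t \<in> {0..}"
    \<comment> \<open>The chain rule asks for the derivative of \<open>x\<close> within the image of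
      the time domain. That image is \<open>{T..}\<close>, a subset of \<open>{0..}\<close> because
      \<open>T\<close> is nonnegative.\<close>
    with \<open>0 \<le> T\<close> have "(x has_vector_derivative projected_field X Q (x (T + t)))
        (at (T + t) within (+) T ` {0..})"
      by (auto intro: has_vector_derivative_within_subset)
    moreover have "((+) T has_vector_derivative 1) (at t within {0..})"
      by (auto intro!: derivative_eq_intros)
    ultimately show "((\<lambda>t. x (T + t)) has_vector_derivative projected_field X Q (x (T + t)))
        (at t within {0..})"
      using vector_diff_chain_within[of "(+) T" 1 t "{0..}" x] by (simp add: o_def)
  qed
  moreover have "abs_continuous_path_on {a..b} (\<lambda>t. x (T + t))" if "{a..b} \<subseteq> {0..}" for a b
  proof (rule abs_continuous_path_on_shift)
    have "{T + a..T + b} \<subseteq> {0..}"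
      using that \<open>0 \<le> T\<close> by auto
    then show "abs_continuous_path_on {T + a..T + b} x"
      using sol unfolding is_solution_def by blast
  qed
  ultimately show ?thesis
    using sol \<open>0 \<le> T\<close> unfolding is_solution_def by (auto simp: image_subset_iff)
qed

text \<open>The equation holds only almost everywhere, but an interval of positive length is not
  negligible, so it holds at some time \<open>t\<close> strictly between \<open>0\<close> and
  \<open>c\<close>. There the derivative of the path is both the field at \<open>l\<close> and
  zero.\<close>

lemma is_solution_const_imp_root:
  assumes sol: "is_solution X Q l I y" and const: "\<And>t. t \<in> I \<Longrightarrow> y t = l"
    and "{0..c} \<subseteq> I" and "0 < c"
  shows "projected_field X Q l = 0"
proof -
  have pos: "\<not> negligible {0<..<c}"
    using \<open>0 < c\<close> by (simp add: open_not_negligible)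
  have neg: "negligible {t. \<not> (t \<in> I \<longrightarrow>
      (y has_vector_derivative projected_field X Q (y t)) (at t within I))}"
    using sol unfolding is_solution_def AE_lebesgue_iff_negligible by blast
  have "\<not> {0<..<c} \<subseteq> {t. \<not> (t \<in> I \<longrightarrow>
      (y has_vector_derivative projected_field X Q (y t)) (at t within I))}"
    using pos negligible_subset[OF neg] by (rule contrapos_nn)
  then obtain t where t: "t \<in> {0<..<c}"
    and "t \<in> I \<longrightarrow> (y has_vector_derivative projected_field X Q (y t)) (at t within I)"
    by blast
  moreover have "t \<in> I"
    using t \<open>{0..c} \<subseteq> I\<close> by auto
  ultimately have "(y has_vector_derivative projected_field X Q l) (at t within I)"
    using const by simp
  then have "(y has_vector_derivative projected_field X Q l) (at t within {0<..<c})"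
    by (rule has_vector_derivative_within_subset) (use \<open>{0..c} \<subseteq> I\<close> in auto)
  \<comment> \<open>Since \<open>t\<close> is an interior point, the derivative within
    \<open>I\<close> becomes an unrestricted one, for which uniqueness is available.\<close>
  then have "(y has_vector_derivative projected_field X Q l) (at t)"
    using t by (simp add: at_within_open[of t "{0<..<c}"])
  moreover have "(y has_vector_derivative 0) (at t)"
  proof (rule has_vector_derivative_transform_within_open[where S = "{0<..<c}"])
    show "((\<lambda>_. l) has_vector_derivative 0) (at t)"
      by simp
    show "l = y s" if "s \<in> {0<..<c}" for s
    proof -
      have "s \<in> I"
        using that \<open>{0..c} \<subseteq> I\<close> by auto
      then show ?thesis
        using const by simp
    qed
  qed (use t in auto)
  ultimately show ?thesis
    by (rule vector_derivative_unique_at)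
qed

lemma life_interval_infinity: "\<tau> x = \<infinity> \<Longrightarrow> life_interval \<tau> x = {0..}"
  by (auto simp: life_interval_def)

text \<open>Every life interval lies in \<open>{0..}\<close>, and maximality forbids it to be a
  proper subset of the domain of \<open>y\<close>. Hence it is all of \<open>{0..}\<close>, and
  uniqueness applies at every nonnegative time.\<close>

lemma well_behaved_global:
  assumes wb: "well_behaved X Q \<tau> G" and "x \<in> X" and sol: "is_solution X Q x {0..} y"
  shows "\<tau> x = \<infinity>" and "0 \<le> t \<Longrightarrow> G (x, t) = y t"
proof -
  have "\<not> life_interval \<tau> x \<subset> {0..}"
    and agree: "\<And>t. t \<in> {0..} \<inter> life_interval \<tau> x \<Longrightarrow> y t = G (x, t)"
    using wb \<open>x \<in> X\<close> sol unfolding well_behaved_def by blast+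
  moreover have "life_interval \<tau> x \<subseteq> {0..}"
    by (auto simp: life_interval_def)
  ultimately have life: "life_interval \<tau> x = {0..}"
    by blast
  show "\<tau> x = \<infinity>"
  proof (rule ereal_top)
    fix B :: real
    \<comment> \<open>The maximum covers negative \<open>B\<close>, since life intervals contain
      nonnegative times only.\<close>
    have "max 0 B \<in> life_interval \<tau> x"
      using life by simp
    then have "ereal (max 0 B) < \<tau> x"
      unfolding life_interval_def by blast
    moreover have "ereal B \<le> ereal (max 0 B)"
      by simp
    ultimately show "ereal B \<le> \<tau> x"
      by (meson less_imp_le order_trans)
  qed
  show "G (x, t) = y t" if "0 \<le> t"
    using that agree life by simp
qed

lemma limit_is_root:
  fixes X :: "'a::euclidean_space set"
  assumes wb: "well_behaved X Q \<tau> G" and "x0 \<in> X" and inf: "\<tau> x0 = \<infinity>"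
    and "l \<in> X" and lim: "((\<lambda>t. G (x0, t)) \<longlongrightarrow> l) at_top"
  shows "projected_field X Q l = 0"
proof -
  have sol: "is_solution X Q x0 {0..} (\<lambda>t. G (x0, t))"
    using wb \<open>x0 \<in> X\<close> life_interval_infinity[of \<tau>, OF inf] unfolding well_behaved_def by metis
  \<comment> \<open>The shifted path is a global solution from \<open>G (x0, T)\<close>, so that
    point has infinite lifetime and its trajectory is the shifted one.\<close>
  have semigroup: "G (x0, T) \<in> X" "\<tau> (G (x0, T)) = \<infinity>" "G (G (x0, T), s) = G (x0, T + s)"
    if "0 \<le> T" "0 \<le> s" for T s
  proof -
    show "G (x0, T) \<in> X"
      using sol \<open>0 \<le> T\<close> unfolding is_solution_def by auto
    from well_behaved_global[OF wb this is_solution_shift[OF sol \<open>0 \<le> T\<close>]]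
    show "\<tau> (G (x0, T)) = \<infinity>" "G (G (x0, T), s) = G (x0, T + s)"
      using \<open>0 \<le> s\<close> by auto
  qed
  let ?D = "SIGMA x:X. life_interval \<tau> x"
  \<comment> \<open>Nothing is known yet about the lifetime of \<open>l\<close>, so only times
    before \<open>\<tau> l\<close> are considered; there \<open>(l, s)\<close> lies in the domain on
    which \<open>G\<close> is continuous.\<close>
  have fixed: "G (l, s) = l" if "s \<in> life_interval \<tau> l" for s
  proof -
    have "0 \<le> s"
      using that by (simp add: life_interval_def)
    have "continuous_on ?D G"
      using wb unfolding well_behaved_def by blast
    moreover have "((\<lambda>T. (G (x0, T), s)) \<longlongrightarrow> (l, s)) at_top"
      using lim by (intro tendsto_intros)
    moreover have "(l, s) \<in> ?D"
      using \<open>l \<in> X\<close> that by simp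
    moreover have "\<forall>\<^sub>F T in at_top. (G (x0, T), s) \<in> ?D"
      using eventually_ge_at_top[of 0] by eventually_elim
        (use semigroup \<open>0 \<le> s\<close> life_interval_infinity in fastforce)
    ultimately have "((\<lambda>T. G (G (x0, T), s)) \<longlongrightarrow> G (l, s)) at_top"
      by (rule continuous_on_tendsto_compose)
    moreover have "\<forall>\<^sub>F T in at_top. G (G (x0, T), s) = G (x0, T + s)"
      using eventually_ge_at_top[of 0] by eventually_elim (use semigroup \<open>0 \<le> s\<close> in blast)
    ultimately have "((\<lambda>T. G (x0, T + s)) \<longlongrightarrow> G (l, s)) at_top"
      by (blast intro: Lim_transform_eventually)
    \<comment> \<open>The same expression is also a tail of the original trajectory, so it tends to
      \<open>l\<close>; the two limits must coincide.\<close>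
    moreover have "filterlim (\<lambda>T. T + s) at_top at_top"
      using filterlim_tendsto_add_at_top[OF tendsto_const filterlim_ident, of s]
      by (simp add: add.commute)
    with lim have "((\<lambda>T. G (x0, T + s)) \<longlongrightarrow> l) at_top"
      by (rule filterlim_compose)
    ultimately show ?thesis
      using tendsto_unique trivial_limit_at_top_linorder by blast
  qed
  have "0 < \<tau> l"
    using wb \<open>l \<in> X\<close> unfolding well_behaved_def by blast
  \<comment> \<open>As \<open>\<tau> l\<close> may be infinite, a finite \<open>c\<close> below it
    is chosen to get a nondegenerate interval on which the path from \<open>l\<close> is
    constant.\<close>
  then obtain c where "0 < ereal c" "ereal c < \<tau> l"
    using ereal_dense2 by blast
  then have "0 < c" "{0..c} \<subseteq> life_interval \<tau> l"
    by (auto simp: life_interval_def intro: le_less_trans[of _ "ereal c"])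
  moreover have "is_solution X Q l (life_interval \<tau> l) (\<lambda>t. G (l, t))"
    using wb \<open>l \<in> X\<close> unfolding well_behaved_def by blast
  ultimately show ?thesis
    using is_solution_const_imp_root fixed by blast
qed

lemma dynamic_solver_root:
  fixes X :: "'a::euclidean_space set"
  assumes wb: "well_behaved X Q \<tau> G" and "x \<in> X" and "projected_field X Q x = 0"
  shows "dynamic_solver X \<tau> G x = Some x"
proof -
  note global = well_behaved_global[OF wb \<open>x \<in> X\<close> is_solution_const[OF assms(2,3)]]
  have "\<forall>\<^sub>F t in at_top. x = G (x, t)"
    using eventually_ge_at_top[of 0] by eventually_elim (simp add: global(2))
  then have "((\<lambda>t. G (x, t)) \<longlongrightarrow> x) at_top"
    by (rule Lim_transform_eventually[OF tendsto_const])
  with \<open>x \<in> X\<close> global(1) show ?thesis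
    unfolding dynamic_solver_def by (auto simp: tendsto_Lim)
qed

lemma dynamic_solver_SomeD:
  fixes X :: "'a::euclidean_space set"
  assumes wb: "well_behaved X Q \<tau> G" and "x0 \<in> X" and "dynamic_solver X \<tau> G x0 = Some l"
  shows "l \<in> X" and "projected_field X Q l = 0"
proof -
  from assms(3) obtain m where "\<tau> x0 = \<infinity>" "m \<in> X" "((\<lambda>t. G (x0, t)) \<longlongrightarrow> m) at_top"
    and "l = Lim at_top (\<lambda>t. G (x0, t))"
    unfolding dynamic_solver_def by (auto split: if_splits)
  \<comment> \<open>\<open>Lim\<close> is a description operator; convergence to \<open>m\<close>
    and uniqueness of limits pin down its value.\<close>
  moreover from this have "l = m"
    by (simp add: tendsto_Lim)
  ultimately show "l \<in> X" and "projected_field X Q l = 0"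
    using limit_is_root[OF wb \<open>x0 \<in> X\<close>] by auto
qed

theorem proposition4p7:
  fixes X :: "(real ^ 'd) set"
    and Q :: "real ^ 'd \<Rightarrow> real ^ 'd"
    and \<tau> :: "real ^ 'd \<Rightarrow> ereal"
    and G :: "(real ^ 'd) \<times> real \<Rightarrow> real ^ 'd"
  assumes "closed X" and "convex X" and "interior X \<noteq> {}"
    and "continuous_on X Q"
    and "well_behaved X Q \<tau> G"
  shows "finite (dynamic_solver X \<tau> G ` X) \<longleftrightarrow> finite {x \<in> X. projected_field X Q x = 0}"
proof
  let ?R = "{x \<in> X. projected_field X Q x = 0}"
  note wb = \<open>well_behaved X Q \<tau> G\<close>
  have "Some ` ?R \<subseteq> dynamic_solver X \<tau> G ` X"
    using dynamic_solver_root[OF wb] by force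
  moreover assume "finite (dynamic_solver X \<tau> G ` X)"
  ultimately have "finite (Some ` ?R)"
    by (rule finite_subset)
  \<comment> \<open>Injectivity of \<open>Some\<close> carries finiteness back from the
    image.\<close>
  then show "finite ?R"
    by (simp add: finite_image_iff)
next
  let ?R = "{x \<in> X. projected_field X Q x = 0}"
  note wb = \<open>well_behaved X Q \<tau> G\<close>
  \<comment> \<open>\<open>None\<close> is the only possible outcome that does not come from a
    root.\<close>
  have "dynamic_solver X \<tau> G x \<in> insert None (Some ` ?R)" if "x \<in> X" for x
    using dynamic_solver_SomeD[OF wb that] by (cases "dynamic_solver X \<tau> G x") auto
  moreover assume "finite ?R"
  ultimately show "finite (dynamic_solver X \<tau> G ` X)"
    by (meson finite.insertI finite_imageI finite_subset image_subsetI)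
qed

end
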